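(* Let $\mathbf{K},\mathbf{M}\in\mathbb{R}^{n_h\times n_h}$ and $\mathbf{c}\in\mathbb{R}^{n_h}$ be the stiffness matrix, mass matrix and mean-value vector of the quadratic Lagrange finite element space $S_h$ (as defined in the context), and let $0\le\tau\le 1$, $0\le\varepsilon\le 1$. Define the $2n_h\times 2n_h$ matrices $$\mathbf{B}=\begin{bmatrix}\frac{\tau^{1/2}}{2}(\mathbf{K}+\mathbf{c}\mathbf{c}^t) & \mathbf{M}\\ \mathbf{M} & -\frac{6\tau^{1/2}}{2}\mathbf{M}-\frac{3\tau^{1/2}\varepsilon^2}{2}(\mathbf{K}+\mathbf{c}\mathbf{c}^t)\end{bmatrix},$$ $$\mathbf{P}=\begin{bmatrix}\frac{\tau^{1/2}}{2}(\mathbf{K}+\mathbf{c}\mathbf{c}^t)+\mathbf{M} & \mathbf{0}\\ \mathbf{0} & \frac{\tau^{1/2}}{2}\varepsilon^2(\mathbf{K}+\mathbf{c}\mathbf{c}^t)+\mathbf{M}\end{bmatrix}.$$ Then there exist two positive constants $C_1$ and $C_2$, independent of $\varepsilon$, $h$ and $\tau$, such that $$C_2\max(\tau^{1/2},\varepsilon)\le|\lambda|\le C_1\qquad\text{for any eigenvalue }\lambda\text{ of }\mathbf{P}^{-1}\mathbf{B}.$$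
   Context: Let $\Omega\subset\mathbb{R}^d$, $d=2,3$, be an open (bounded, connected) polygonal or polyhedral domain, and let $\mathcal{T}_h$ be a quasi-uniform family of triangulations of $\Omega$ indexed by the mesh size $h$. The finite element space is $$S_h=\{v\in C(\bar\Omega):\ v|_K\in\mathcal{P}_2(K)\ \ \forall\,K\in\mathcal{T}_h\},$$ where $\mathcal{P}_2(K)$ denotes the polynomials of total degree at most $2$ on $K$. Let $n_h=\dim S_h$ and let $\varphi_1,\ldots,\varphi_{n_h}$ be the standard nodal basis functions of $S_h$. With $(\cdot,\cdot)$ the $L^2(\Omega)$ inner product, define for $1\le k,\ell\le n_h$: - the stiffness matrix $\mathbf{K}(k,\ell)=(\nabla\varphi_k,\nabla\varphi_\ell)$, - the mass matrix $\mathbf{M}(k,\ell)=(\varphi_k,\varphi_\ell)$, - the (column) vector $\mathbf{c}(k)=(\varphi_k,1)$. Here $\mathbf{c}^t$ is the transpose of $\mathbf{c}$. The parameters $\tau$ and $\varepsilon$ (time step size and interfacial width parameter) are real numbers. "Independent of $\varepsilon$, $h$ and $\tau$" means that the same constants $C_1,C_2$ work for all $\tau,\varepsilon\in[0,1]$ and all triangulations $\mathcal{T}_h$ in the family. *)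

theory Defs
  imports
    "HOL-Analysis.Analysis"
    "HOL-Library.Function_Algebras"
    "Jordan_Normal_Form.Char_Poly"
    "Jordan_Normal_Form.Gauss_Jordan_Elimination"
begin

(* Both libraries use the dollar sign for vector indexing; below it is the coordinate of a
   point of real^'d, and matrices are those of Jordan_Normal_Form, indexed from 0. *)
no_notation Matrix.vec_index (infixl "$" 100)

section \<open>Domains and triangulations\<close>

(* For d = 2 the boundary is a finite union of segments, for d = 3 of convex polygons.
   No Lipschitz condition on the boundary is imposed. *)
definition polyhedral_domain :: "(real^'d) set \<Rightarrow> bool" where
  "polyhedral_domain \<Omega> \<longleftrightarrow>
     open \<Omega> \<and> bounded \<Omega> \<and> connected \<Omega> \<and> \<Omega> \<noteq> {} \<and>
     (\<exists>\<F>. finite \<F> \<and> (\<forall>F\<in>\<F>. polytope F \<and> aff_dim F = int CARD('d) - 1) \<and>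
          frontier \<Omega> = \<Union>\<F>)"

(* The elements of the mesh are closed d-simplices; the library predicate triangulation
   says that there are finitely many and that any two meet in a (possibly empty) common face. *)
definition triangulates :: "(real^'d) set set \<Rightarrow> (real^'d) set \<Rightarrow> bool" where
  "triangulates \<T> \<Omega> \<longleftrightarrow>
     triangulation \<T> \<and> (\<forall>K\<in>\<T>. int CARD('d) simplex K) \<and> \<Union>\<T> = closure \<Omega>"

definition mesh_size :: "(real^'d) set set \<Rightarrow> real" where
  "mesh_size \<T> = Max (diameter ` \<T>)"

(* H is the set of mesh sizes occurring in the family. One constant bounds the inradius of every
   element of every mesh from below by a multiple of the global mesh size. *)
definition quasi_uniform_family ::
  "(real^'d) set \<Rightarrow> real set \<Rightarrow> (real \<Rightarrow> (real^'d) set set) \<Rightarrow> bool" where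
  "quasi_uniform_family \<Omega> H \<T> \<longleftrightarrow>
     (\<forall>h\<in>H. triangulates (\<T> h) \<Omega> \<and> mesh_size (\<T> h) = h) \<and>
     (\<exists>\<rho>>0. \<forall>h\<in>H. \<forall>K\<in>\<T> h. \<exists>x. ball x (\<rho> * h) \<subseteq> K)"

section \<open>The quadratic Lagrange finite element space\<close>

definition poly2 :: "((real^'d) \<Rightarrow> real) set" where
  "poly2 = {p. \<exists>(a::real) (b::'d \<Rightarrow> real) (q::'d \<Rightarrow> 'd \<Rightarrow> real).
     p = (\<lambda>x. a + (\<Sum>i\<in>UNIV. b i * x$i) + (\<Sum>i\<in>UNIV. \<Sum>j\<in>UNIV. q i j * x$i * x$j))}"

(* A function on the closure of Omega is represented by its extension by 0, so that functions in
   S_h are equal as soon as they agree there. *)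
definition fe_space :: "(real^'d) set \<Rightarrow> (real^'d) set set \<Rightarrow> ((real^'d) \<Rightarrow> real) set" where
  "fe_space \<Omega> \<T> =
     {v. continuous_on (closure \<Omega>) v \<and> (\<forall>x. x \<notin> closure \<Omega> \<longrightarrow> v x = 0) \<and>
         (\<forall>K\<in>\<T>. \<exists>p\<in>poly2. \<forall>x\<in>K. v x = p x)}"

interpretation pointwise: vector_space "\<lambda>(c::real) (v::'a \<Rightarrow> real). (\<lambda>x. c * v x)"
  by unfold_locales (auto simp: fun_eq_iff algebra_simps)

definition fe_dim :: "(real^'d) set \<Rightarrow> (real^'d) set set \<Rightarrow> nat" where
  "fe_dim \<Omega> \<T> = pointwise.dim (fe_space \<Omega> \<T>)"

(* Vertices (the case u = w) and edge midpoints: any two vertices of a simplex span an edge. *)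
definition nodes :: "(real^'d) set set \<Rightarrow> (real^'d) set" where
  "nodes \<T> = {midpoint u w |u w K. K \<in> \<T> \<and> u extreme_point_of K \<and> w extreme_point_of K}"

(* The standard nodal basis functions, for some enumeration p of the nodes. *)
definition nodal_basis ::
  "(real^'d) set \<Rightarrow> (real^'d) set set \<Rightarrow> (nat \<Rightarrow> (real^'d) \<Rightarrow> real) \<Rightarrow> bool" where
  "nodal_basis \<Omega> \<T> \<phi> \<longleftrightarrow>
     (\<exists>p. bij_betw p {..<fe_dim \<Omega> \<T>} (nodes \<T>) \<and>
          (\<forall>k<fe_dim \<Omega> \<T>. \<phi> k \<in> fe_space \<Omega> \<T> \<and>
             (\<forall>l<fe_dim \<Omega> \<T>. \<phi> k (p l) = (if k = l then 1 else 0))))"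

section \<open>Finite element matrices\<close>

(* Integrals are over the complete measure lebesgue. Functions of S_h are smooth in the interior
   of every element, so the classical gradient is defined almost everywhere in Omega and coincides
   with the weak gradient; its values on the null set where it does not exist are immaterial. *)
definition L2_inner :: "(real^'d) set \<Rightarrow> ((real^'d) \<Rightarrow> real) \<Rightarrow> ((real^'d) \<Rightarrow> real) \<Rightarrow> real" where
  "L2_inner \<Omega> u v = (LINT x:\<Omega>|lebesgue. u x * v x)"

definition gradient :: "((real^'d) \<Rightarrow> real) \<Rightarrow> real^'d \<Rightarrow> real^'d" where
  "gradient u x = (THE D. GDERIV u x :> D)"

definition L2_inner_grad :: "(real^'d) set \<Rightarrow> ((real^'d) \<Rightarrow> real) \<Rightarrow> ((real^'d) \<Rightarrow> real) \<Rightarrow> real" where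
  "L2_inner_grad \<Omega> u v = (LINT x:\<Omega>|lebesgue. gradient u x \<bullet> gradient v x)"

definition stiffness_mat :: "(real^'d) set \<Rightarrow> nat \<Rightarrow> (nat \<Rightarrow> (real^'d) \<Rightarrow> real) \<Rightarrow> real mat" where
  "stiffness_mat \<Omega> n \<phi> = mat n n (\<lambda>(k, l). L2_inner_grad \<Omega> (\<phi> k) (\<phi> l))"

definition mass_mat :: "(real^'d) set \<Rightarrow> nat \<Rightarrow> (nat \<Rightarrow> (real^'d) \<Rightarrow> real) \<Rightarrow> real mat" where
  "mass_mat \<Omega> n \<phi> = mat n n (\<lambda>(k, l). L2_inner \<Omega> (\<phi> k) (\<phi> l))"

(* a column vector, i.e. an n x 1 matrix *)
definition mean_col :: "(real^'d) set \<Rightarrow> nat \<Rightarrow> (nat \<Rightarrow> (real^'d) \<Rightarrow> real) \<Rightarrow> real mat" where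
  "mean_col \<Omega> n \<phi> = mat n 1 (\<lambda>(k, _). L2_inner \<Omega> (\<phi> k) (\<lambda>_. 1))"

definition B_mat :: "real mat \<Rightarrow> real mat \<Rightarrow> real mat \<Rightarrow> real \<Rightarrow> real \<Rightarrow> real mat" where
  "B_mat K M c \<tau> \<epsilon> = four_block_mat
     ((sqrt \<tau> / 2) \<cdot>\<^sub>m (K + c * transpose_mat c)) M
     M (- ((6 * sqrt \<tau> / 2) \<cdot>\<^sub>m M) - (3 * sqrt \<tau> * \<epsilon>\<^sup>2 / 2) \<cdot>\<^sub>m (K + c * transpose_mat c))"

definition P_mat :: "nat \<Rightarrow> real mat \<Rightarrow> real mat \<Rightarrow> real mat \<Rightarrow> real \<Rightarrow> real \<Rightarrow> real mat" where
  "P_mat n K M c \<tau> \<epsilon> = four_block_mat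
     ((sqrt \<tau> / 2) \<cdot>\<^sub>m (K + c * transpose_mat c) + M) (0\<^sub>m n n)
     (0\<^sub>m n n) ((sqrt \<tau> / 2 * \<epsilon>\<^sup>2) \<cdot>\<^sub>m (K + c * transpose_mat c) + M)"

end

theory Submission
  imports Defs
begin

text \<open>
  Put \<open>A = K + c c\<^sup>t\<close>, which is positive semidefinite, while \<open>M\<close> is positive definite. Eliminating one
  block of the eigenvalue equation \<open>B w = \<mu> P w\<close> yields \<open>f(T) x = 0\<close> for a quadratic polynomial \<open>f\<close>
  depending on \<open>\<mu>\<close>, with \<open>T = M\<^sup>-\<^sup>1 A\<close> and \<open>x \<noteq> 0\<close>. Hence \<open>f\<close> vanishes at an
  eigenvalue of \<open>T\<close> (or identically), that is, at some \<open>r \<ge> 0\<close>. With \<open>u = \<tau>\<^sup>1\<^sup>/\<^sup>2 r / 2\<close> the equation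
  \<open>f(r) = 0\<close> is a scalar quadratic equation for \<open>\<mu>\<close>, whose roots are bounded above and below uniformly in
  \<open>u \<ge> 0\<close>; this is why the constants do not depend on the mesh.
\<close>

section \<open>Eigenvalues of the preconditioned block matrix\<close>

text \<open>Expanding the product gives \<open>a * \<mu>^2 + b * \<mu> = c\<close>, with every
  coefficient controlled by \<open>a\<close>: \<open>\<bar>b\<bar> \<le> 4 * a\<close> and
  \<open>0 \<le> c \<le> 3 * a\<close> bound \<mu> above, and \<open>max s e * a \<le> 2 * c\<close>
  then bounds it below. None of these ratios deteriorates as \<open>u\<close> grows.\<close>

lemma pencil_root_bounds:
  fixes s e u :: real and \<mu> :: complex
  assumes s: "0 \<le> s" "s \<le> 1" and e: "0 \<le> e" "e \<le> 1" and u: "0 \<le> u"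
    and root: "(\<mu> * (1 + u) - u) * (\<mu> * (1 + e\<^sup>2 * u) + 3 * s + 3 * e\<^sup>2 * u) = 1"
  shows "1 / 18 * max s e \<le> cmod \<mu>" and "cmod \<mu> \<le> 5"
proof -
  define a where "a = (1 + u) * (1 + e\<^sup>2 * u)"
  define b where "b = (1 + u) * (3 * s + 3 * e\<^sup>2 * u) - u * (1 + e\<^sup>2 * u)"
  define c where "c = 1 + 3 * s * u + 3 * e\<^sup>2 * u\<^sup>2"
  have quadratic: "complex_of_real a * \<mu>\<^sup>2 + of_real b * \<mu> = of_real c"
    using root by (simp add: a_def b_def c_def algebra_simps power2_eq_square)
  have e2: "e\<^sup>2 \<le> 1" "0 \<le> e\<^sup>2"
    using e by (auto simp: power_le_one)
  have a: "1 \<le> a"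
    using u e2 by (simp add: a_def algebra_simps)
  have su: "s * u \<le> u" "0 \<le> s * u"
    using s u by (auto simp: mult_left_le_one_le)
  have eu: "0 \<le> e\<^sup>2 * u" using e2 u by simp
  define q where "q = e\<^sup>2 * u\<^sup>2"
  have q: "0 \<le> q"
    by (simp add: q_def)
  then have c: "0 \<le> c" "c \<le> 3 * a"
    unfolding q_def using su u e2 eu by (auto simp: a_def c_def algebra_simps power2_eq_square)
  have b: "\<bar>b\<bar> \<le> 4 * a"
  proof -
    \<comment> \<open>\<open>b\<close> is a difference of two nonnegative terms, the first at most
      \<open>3 * a\<close> and the second at most \<open>a\<close>.\<close>
    have "0 \<le> (1 + u) * (3 * s + 3 * e\<^sup>2 * u)"
      using s u eu by simp
    moreover have "(1 + u) * (3 * s + 3 * e\<^sup>2 * u) \<le> (1 + u) * (3 * (1 + e\<^sup>2 * u))"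
      using s u by (intro mult_left_mono) auto
    moreover have "0 \<le> u * (1 + e\<^sup>2 * u)" "u * (1 + e\<^sup>2 * u) \<le> a"
      unfolding a_def using u eu by (auto intro!: mult_right_mono)
    moreover have "(1 + u) * (3 * (1 + e\<^sup>2 * u)) = 3 * a"
      by (simp add: a_def)
    ultimately show ?thesis
      unfolding b_def abs_le_iff using a by linarith
  qed
  have b\<mu>: "cmod (of_real b * \<mu>) \<le> 4 * a * cmod \<mu>"
    using b by (simp add: norm_mult mult_right_mono)
  have "a * (cmod \<mu>)\<^sup>2 = cmod (of_real a * \<mu>\<^sup>2)"
    using a by (simp add: norm_mult norm_power)
  also have "of_real a * \<mu>\<^sup>2 = of_real c - of_real b * \<mu>"
    using quadratic by (simp add: eq_diff_eq)
  also have "cmod \<dots> \<le> 3 * a + 4 * a * cmod \<mu>"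
    by (rule order.trans[OF norm_triangle_ineq4]) (use b\<mu> c in simp)
  finally have "a * (cmod \<mu>)\<^sup>2 \<le> a * (3 + 4 * cmod \<mu>)"
    by (simp add: algebra_simps)
  then have "(cmod \<mu>)\<^sup>2 \<le> 3 + 4 * cmod \<mu>"
    using a by simp
  \<comment> \<open>Completing the square leaves 7 on the right, which is rounded up to 9; hence the
    bound 5 = 2 + 3.\<close>
  then have "(cmod \<mu> - 2)\<^sup>2 \<le> 3\<^sup>2"
    by (simp add: power2_eq_square algebra_simps)
  then show upper: "cmod \<mu> \<le> 5"
    using power2_le_imp_le[of "cmod \<mu> - 2" 3] by simp
  have "c = cmod (of_real a * \<mu>\<^sup>2 + of_real b * \<mu>)"
    unfolding quadratic using c by simp
  also have "\<dots> \<le> a * (cmod \<mu> * cmod \<mu>) + 4 * a * cmod \<mu>"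
    by (rule order.trans[OF norm_triangle_ineq]) (use b\<mu> a in \<open>simp add: norm_mult norm_power power2_eq_square\<close>)
  \<comment> \<open>The bound 5 replaces one factor of the quadratic term, so the right-hand side
    becomes linear in \<open>cmod \<mu>\<close>, with 9 = 5 + 4.\<close>
  also have "\<dots> \<le> a * (5 * cmod \<mu>) + 4 * a * cmod \<mu>"
    using upper a by (intro add_right_mono mult_left_mono mult_right_mono) auto
  finally have c_le: "c \<le> a * (9 * cmod \<mu>)"
    by simp
  have c_eq: "c = 1 + 3 * (s * u) + 3 * q"
    by (simp add: c_def q_def)
  \<comment> \<open>In the expansion of \<open>y * a\<close>, the term with \<open>e^2 * u\<close>
    is at most \<open>y * u\<close> because \<open>e^2 \<le> 1\<close>, and \<open>y * q\<close> is
    at most \<open>q\<close> because \<open>y \<le> 1\<close>.\<close>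
  have y: "y * a \<le> y + 2 * (y * u) + q" if "0 \<le> y" "y \<le> 1" for y
  proof -
    have "y * a = y + y * u + y * (e\<^sup>2 * u) + y * q"
      by (simp add: a_def q_def algebra_simps power2_eq_square)
    also have "\<dots> \<le> y + y * u + y * u + q"
      using that q e2 u by (intro add_mono mult_left_mono mult_left_le_one_le order.refl) auto
    finally show ?thesis by (simp add: mult_ac)
  qed
  have "s * a \<le> 2 * c"
    unfolding c_eq using y[OF s] s su q by (simp add: distrib_left mult_ac)
  moreover have "e * a \<le> 2 * c"
  proof -
    \<comment> \<open>\<open>c\<close> contains \<open>s * u\<close> but not \<open>e * u\<close>;
      since \<open>q\<close> is the square of \<open>e * u\<close>, the arithmetic-geometric mean
      inequality absorbs the latter into \<open>1 + q\<close>.\<close>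
    have "2 * (e * u) \<le> 1 + q"
      using sum_squares_bound[of 1 "e * u"] by (simp add: q_def power_mult_distrib)
    then show ?thesis
      unfolding c_eq using y[OF e] e su q by (simp add: distrib_left mult_ac)
  qed
  ultimately have "max s e * a \<le> 2 * c"
    by (simp add: max_def)
  then have "a * max s e \<le> a * (18 * cmod \<mu>)"
    using c_le by (simp add: algebra_simps)
  then show "1 / 18 * max s e \<le> cmod \<mu>"
    using a by simp
qed

text \<open>Over the complex numbers the quadratic factors as
  \<open>a * (T - t1) * (T - t2)\<close>: either \<open>(T - t2) x\<close> vanishes and
  \<open>x\<close> is an eigenvector for \<open>t2\<close>, or it is itself an eigenvector for
  \<open>t1\<close>. The alternative \<open>t = 0\<close> covers the identically vanishing
  polynomial, which singles out no eigenvalue.\<close>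

lemma root_of_annihilating_quadratic:
  fixes T :: "complex mat"
  assumes T: "T \<in> carrier_mat n n" and x: "x \<in> carrier_vec n" "x \<noteq> 0\<^sub>v n"
    and eq: "a \<cdot>\<^sub>v (T *\<^sub>v (T *\<^sub>v x)) + b \<cdot>\<^sub>v (T *\<^sub>v x) + c \<cdot>\<^sub>v x = 0\<^sub>v n"
  shows "\<exists>t. a * t\<^sup>2 + b * t + c = 0 \<and> (t = 0 \<or> eigenvalue T t)"
proof -
  have eqi: "a * vec_index (T *\<^sub>v (T *\<^sub>v x)) i + b * vec_index (T *\<^sub>v x) i + c * vec_index x i = 0"
    if "i < n" for i
    using arg_cong[OF eq, of "\<lambda>v. vec_index v i"] that T x by simp
  have eigI: "eigenvalue T t" if "v \<in> carrier_vec n" "v \<noteq> 0\<^sub>v n" "T *\<^sub>v v = t \<cdot>\<^sub>v v" for v t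
    using that T unfolding eigenvalue_def eigenvector_def by auto
  have Tx: "T *\<^sub>v x \<in> carrier_vec n" "T *\<^sub>v (T *\<^sub>v x) \<in> carrier_vec n"
    using T x by auto
  consider "a \<noteq> 0" | "a = 0" "b \<noteq> 0" | "a = 0" "b = 0"
    by blast
  then show ?thesis
  proof cases
    case 1
    define d where "d = csqrt (b\<^sup>2 - 4 * a * c)"
    have d: "d\<^sup>2 = b\<^sup>2 - 4 * a * c" by (simp add: d_def)
    define t1 where "t1 = (- b + d) / (2 * a)"
    define t2 where "t2 = (- b - d) / (2 * a)"
    have b: "b = - a * (t1 + t2)" using 1 by (simp add: t1_def t2_def field_simps)
    have "t1 * t2 = (b\<^sup>2 - d\<^sup>2) / (4 * a\<^sup>2)"
      by (simp add: t1_def t2_def algebra_simps power2_eq_square diff_divide_distrib add_divide_distrib)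
    then have "t1 * t2 = c / a" using 1 d by (simp add: power2_eq_square)
    then have c: "c = a * (t1 * t2)" using 1 by simp
    have roots: "a * t1\<^sup>2 + b * t1 + c = 0" "a * t2\<^sup>2 + b * t2 + c = 0"
      unfolding b c by (simp_all add: algebra_simps power2_eq_square)
    define v where "v = T *\<^sub>v x - t2 \<cdot>\<^sub>v x"
    have v: "v \<in> carrier_vec n" using Tx x by (simp add: v_def)
    have Tv: "T *\<^sub>v v = T *\<^sub>v (T *\<^sub>v x) - t2 \<cdot>\<^sub>v (T *\<^sub>v x)"
      unfolding v_def using T x Tx by (simp add: mult_minus_distrib_mat_vec mult_mat_vec)
    show ?thesis
    proof (cases "v = 0\<^sub>v n")
      case True
      have "T *\<^sub>v x = t2 \<cdot>\<^sub>v x"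
      proof (rule eq_vecI)
        fix i assume "i < dim_vec (t2 \<cdot>\<^sub>v x)"
        then have i: "i < n" using x by simp
        with arg_cong[OF True, of "\<lambda>v. vec_index v i"]
        show "vec_index (T *\<^sub>v x) i = vec_index (t2 \<cdot>\<^sub>v x) i"
          using T x by (simp add: v_def)
      qed (use T x in simp)
      then show ?thesis using eigI[OF x] roots by blast
    next
      case False
      have "T *\<^sub>v v = t1 \<cdot>\<^sub>v v"
      proof (rule eq_vecI)
        fix i assume "i < dim_vec (t1 \<cdot>\<^sub>v v)"
        then have i: "i < n" using v by simp
        have "a * vec_index (T *\<^sub>v v) i = a * vec_index (t1 \<cdot>\<^sub>v v) i"
          unfolding Tv using eqi[OF i] i T x Tx by (simp add: v_def b c algebra_simps del: index_mult_mat_vec)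
        with 1 show "vec_index (T *\<^sub>v v) i = vec_index (t1 \<cdot>\<^sub>v v) i"
          by simp
      qed (use T v in simp)
      then show ?thesis using eigI[OF v False] roots by blast
    qed
  next
    case 2
    have "T *\<^sub>v x = (- c / b) \<cdot>\<^sub>v x"
    proof (rule eq_vecI)
      fix i assume "i < dim_vec ((- c / b) \<cdot>\<^sub>v x)"
      then have i: "i < n" using x by simp
      show "vec_index (T *\<^sub>v x) i = vec_index ((- c / b) \<cdot>\<^sub>v x) i"
        using eqi[OF i] 2 i x T by (simp add: field_simps eq_neg_iff_add_eq_0 del: index_mult_mat_vec)
    qed (use T x in simp)
    moreover have "a * (- c / b)\<^sup>2 + b * (- c / b) + c = 0" using 2 by simp
    ultimately show ?thesis using eigI[OF x] by blast
  next
    case 3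
    \<comment> \<open>A nonzero entry of \<open>x\<close> forces \<open>c = 0\<close>, so every
      number is a root and 0 may be chosen.\<close>
    obtain i where "i < n" "vec_index x i \<noteq> 0"
      using x by (metis eq_vecI carrier_vecD index_zero_vec)
    then have "c = 0" using eqi[of i] 3 by simp
    with 3 show ?thesis by auto
  qed
qed

section \<open>Quadratic forms, definiteness and generalized eigenvalues\<close>

definition form_on :: "nat \<Rightarrow> real mat \<Rightarrow> (nat \<Rightarrow> real) \<Rightarrow> real" where
  "form_on n A v = (\<Sum>i<n. \<Sum>j<n. v i * v j * A $$ (i, j))"

text \<open>Symmetry is included because over the reals it does not follow from the sign of the
  form, and it is what makes the associated complex form real. Vectors are functions on the naturals
  of which only the values below \<open>n\<close> count, so no carrier conditions arise.\<close>

definition pos_semidef :: "nat \<Rightarrow> real mat \<Rightarrow> bool" where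
  "pos_semidef n A \<longleftrightarrow> A \<in> carrier_mat n n \<and> (\<forall>i<n. \<forall>j<n. A $$ (i, j) = A $$ (j, i)) \<and>
     (\<forall>v. 0 \<le> form_on n A v)"

definition pos_def :: "nat \<Rightarrow> real mat \<Rightarrow> bool" where
  "pos_def n A \<longleftrightarrow> pos_semidef n A \<and> (\<forall>v. form_on n A v = 0 \<longrightarrow> (\<forall>i<n. v i = 0))"

lemma form_on_add:
  "A \<in> carrier_mat n n \<Longrightarrow> B \<in> carrier_mat n n \<Longrightarrow> form_on n (A + B) v = form_on n A v + form_on n B v"
  by (simp add: form_on_def algebra_simps sum.distrib)

lemma form_on_smult:
  "A \<in> carrier_mat n n \<Longrightarrow> form_on n (k \<cdot>\<^sub>m A) v = k * form_on n A v"
  by (simp add: form_on_def sum_distrib_left mult_ac)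

lemma pos_semidef_add:
  "pos_semidef n A \<Longrightarrow> pos_semidef n B \<Longrightarrow> pos_semidef n (A + B)"
  unfolding pos_semidef_def by (auto simp: form_on_add)

lemma pos_semidef_smult: "pos_semidef n A \<Longrightarrow> 0 \<le> k \<Longrightarrow> pos_semidef n (k \<cdot>\<^sub>m A)"
  unfolding pos_semidef_def by (auto simp: form_on_smult)

lemma pos_def_add: "pos_semidef n A \<Longrightarrow> pos_def n B \<Longrightarrow> pos_def n (A + B)"
  unfolding pos_def_def
  by (auto simp: pos_semidef_add) (metis form_on_add pos_semidef_def add_nonneg_eq_0_iff)

text \<open>The form is the square of the linear functional
  \<open>\<Sum>i<n. v i * c $$ (i, 0)\<close>.\<close>

lemma pos_semidef_outer_product:
  assumes c: "c \<in> carrier_mat n 1"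
  shows "pos_semidef n (c * transpose_mat c)"
proof -
  have entry: "(c * transpose_mat c) $$ (i, j) = c $$ (i, 0) * c $$ (j, 0)" if "i < n" "j < n" for i j
    using c that by (simp add: scalar_prod_def)
  have "form_on n (c * transpose_mat c) v = (\<Sum>i<n. v i * c $$ (i, 0))\<^sup>2" for v
    by (simp add: form_on_def entry power2_eq_square sum_product mult_ac)
  then show ?thesis
    using c by (auto simp: pos_semidef_def entry simp del: index_mult_mat)
qed

text \<open>\<open>mat_inverse\<close> returns an option. A trivial kernel makes the determinant
  nonzero, so \<open>A\<close> is a unit of the matrix ring and \<open>None\<close> is excluded.
  Applied to both \<open>P\<close> and \<open>M\<close>.\<close>

lemma the_mat_inverse:
  fixes A :: "real mat"
  assumes A: "A \<in> carrier_mat n n"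
    and inj: "\<And>v. v \<in> carrier_vec n \<Longrightarrow> A *\<^sub>v v = 0\<^sub>v n \<Longrightarrow> v = 0\<^sub>v n"
  shows "the (mat_inverse A) \<in> carrier_mat n n" "A * the (mat_inverse A) = 1\<^sub>m n"
    "the (mat_inverse A) * A = 1\<^sub>m n"
proof -
  have "Determinant.det A \<noteq> 0"
    using det_0_iff_vec_prod_zero[OF A] inj by blast
  then have "A \<in> Units (ring_mat TYPE(real) n ())"
    by (rule det_non_zero_imp_unit[OF A])
  then obtain B where "mat_inverse A = Some B"
    using mat_inverse(1)[OF A, where b = "()"] by (cases "mat_inverse A") auto
  with mat_inverse(2)[OF A] show "the (mat_inverse A) \<in> carrier_mat n n"
    "A * the (mat_inverse A) = 1\<^sub>m n" "the (mat_inverse A) * A = 1\<^sub>m n" by auto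
qed

lemma mult_mat_vec_index_sum:
  assumes "A \<in> carrier_mat m n" "v \<in> carrier_vec n" "i < m"
  shows "vec_index (A *\<^sub>v v) i = (\<Sum>j<n. A $$ (i, j) * vec_index v j)"
  using assms by (simp add: scalar_prod_def atLeast0LessThan)

lemma pos_def_kernel:
  assumes A: "pos_def n A" and v: "v \<in> carrier_vec n" and "A *\<^sub>v v = 0\<^sub>v n"
  shows "v = 0\<^sub>v n"
proof -
  have Ac: "A \<in> carrier_mat n n" using A by (simp add: pos_def_def pos_semidef_def)
  have "form_on n A (vec_index v) = (\<Sum>i<n. vec_index v i * vec_index (A *\<^sub>v v) i)"
    by (simp add: form_on_def mult_mat_vec_index_sum[OF Ac v] sum_distrib_left mult_ac del: index_mult_mat_vec)
  then have "form_on n A (vec_index v) = 0"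
    using assms(3) by simp
  then show ?thesis
    using A v by (auto simp: pos_def_def intro!: eq_vecI)
qed

text \<open>The imaginary part changes sign when \<open>i\<close> and \<open>j\<close> are exchanged
  and therefore cancels; the real part separates into products of real parts and products of
  imaginary parts.\<close>

lemma symmetric_complex_form:
  fixes A :: "real mat" and w :: "nat \<Rightarrow> complex"
  assumes sym: "\<forall>i<n. \<forall>j<n. A $$ (i, j) = A $$ (j, i)"
  shows "(\<Sum>i<n. \<Sum>j<n. cnj (w i) * w j * A $$ (i, j)) =
    of_real (form_on n A (\<lambda>i. Re (w i)) + form_on n A (\<lambda>i. Im (w i)))"
proof (rule complex_eqI)
  have "(\<Sum>i<n. \<Sum>j<n. Im (w i) * Re (w j) * A $$ (i, j)) = (\<Sum>i<n. \<Sum>j<n. Re (w i) * Im (w j) * A $$ (i, j))"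
    by (subst sum.swap) (intro sum.cong refl, use sym in auto)
  then show "Im (\<Sum>i<n. \<Sum>j<n. cnj (w i) * w j * A $$ (i, j)) =
    Im (of_real (form_on n A (\<lambda>i. Re (w i)) + form_on n A (\<lambda>i. Im (w i))))"
    by (simp add: algebra_simps sum_subtractf mult_ac)
qed (simp add: form_on_def algebra_simps sum.distrib)

text \<open>Rayleigh quotient: pairing the equation with the conjugate of \<open>w\<close> gives
  \<open>f A = t * f M\<close> with \<open>f A \<ge> 0\<close> and \<open>f M > 0\<close>.\<close>

lemma generalized_eigenvalue_nonneg:
  fixes A M :: "real mat"
  assumes A: "pos_semidef n A" and M: "pos_def n M"
    and w: "w \<in> carrier_vec n" "w \<noteq> 0\<^sub>v n"
    and eq: "map_mat complex_of_real A *\<^sub>v w = t \<cdot>\<^sub>v (map_mat complex_of_real M *\<^sub>v w)"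
  shows "\<exists>r\<ge>0. t = of_real r"
proof -
  define f where "f = (\<lambda>A. form_on n A (\<lambda>i. Re (vec_index w i)) + form_on n A (\<lambda>i. Im (vec_index w i)))"
  have form: "(\<Sum>i<n. cnj (vec_index w i) * vec_index (map_mat complex_of_real A *\<^sub>v w) i) = of_real (f A)"
    if "pos_semidef n A" for A
  proof -
    have Ac: "map_mat complex_of_real A \<in> carrier_mat n n" using that by (simp add: pos_semidef_def)
    show ?thesis
      unfolding f_def
      using that Ac
      by (subst symmetric_complex_form[symmetric])
        (auto simp: pos_semidef_def mult_mat_vec_index_sum[OF Ac w(1)] sum_distrib_left mult_ac
          simp del: index_mult_mat_vec intro!: sum.cong)
  qed
  have M': "pos_semidef n M" using M by (simp add: pos_def_def)
  have dims: "dim_row M = n" using M' by (auto simp: pos_semidef_def)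
  have "of_real (f A) = t * of_real (f M)"
    unfolding form[OF A, symmetric] form[OF M', symmetric] eq
    by (simp add: sum_distrib_left mult_ac dims del: index_mult_mat_vec)
  moreover have "0 \<le> f A"
    using A by (simp add: f_def pos_semidef_def)
  moreover have "0 < f M"
  proof -
    obtain i where "i < n" "vec_index w i \<noteq> 0"
      using w by (metis eq_vecI carrier_vecD index_zero_vec)
    then have "form_on n M (\<lambda>i. Re (vec_index w i)) \<noteq> 0 \<or> form_on n M (\<lambda>i. Im (vec_index w i)) \<noteq> 0"
      using M unfolding pos_def_def by (metis complex_eq_iff zero_complex.simps)
    moreover have "0 \<le> form_on n M v" for v
      using M' by (simp add: pos_semidef_def)
    ultimately show ?thesis
      unfolding f_def by (auto simp: order_less_le add_nonneg_eq_0_iff)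
  qed
  ultimately show ?thesis
    by (intro exI[of _ "f A / f M"]) (auto simp: field_simps)
qed

section \<open>Reduction of the block eigenvalue problem to the scalar equation\<close>

lemma map_smult_of_real:
  "map_mat complex_of_real (k \<cdot>\<^sub>m A) = of_real k \<cdot>\<^sub>m map_mat complex_of_real A"
  by (rule eq_matI) auto

lemma zero_append: "0\<^sub>v m @\<^sub>v 0\<^sub>v n = 0\<^sub>v (m + n)"
  by (rule eq_vecI) auto

lemma linear_combination_mult_mat_vec:
  fixes A B :: "real mat"
  assumes A: "A \<in> carrier_mat n n" and B: "B \<in> carrier_mat n n" and v: "v \<in> carrier_vec n"
  shows "map_mat complex_of_real (a \<cdot>\<^sub>m A + b \<cdot>\<^sub>m B) *\<^sub>v v =
    of_real a \<cdot>\<^sub>v (map_mat of_real A *\<^sub>v v) + of_real b \<cdot>\<^sub>v (map_mat of_real B *\<^sub>v v)"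
proof (rule eq_vecI)
  fix i
  assume "i < dim_vec (complex_of_real a \<cdot>\<^sub>v (map_mat of_real A *\<^sub>v v) + of_real b \<cdot>\<^sub>v (map_mat of_real B *\<^sub>v v))"
  then have i: "i < n" using B by simp
  have "map_mat complex_of_real (a \<cdot>\<^sub>m A + b \<cdot>\<^sub>m B) \<in> carrier_mat n n"
    "map_mat complex_of_real A \<in> carrier_mat n n" "map_mat complex_of_real B \<in> carrier_mat n n"
    using A B by auto
  note sums = this[THEN mult_mat_vec_index_sum, OF v i]
  show "vec_index (map_mat complex_of_real (a \<cdot>\<^sub>m A + b \<cdot>\<^sub>m B) *\<^sub>v v) i =
    vec_index (of_real a \<cdot>\<^sub>v (map_mat of_real A *\<^sub>v v) + of_real b \<cdot>\<^sub>v (map_mat of_real B *\<^sub>v v)) i"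
    using A B i by (simp add: sums sum_distrib_left sum.distrib algebra_simps del: index_mult_mat_vec)
qed (use A B in auto)

text \<open>Here \<open>s\<close> stands for \<open>sqrt \<tau>\<close> and \<open>A\<close> for the
  stiffness matrix plus the outer product. The matrices enter through definiteness alone and
  \<open>n\<close> is arbitrary, so the same two constants serve all meshes.\<close>

lemma preconditioned_eigenvalue_bounds:
  fixes A M :: "real mat" and s e :: real and \<mu> :: complex
  assumes A: "pos_semidef n A" and M: "pos_def n M"
    and s: "0 \<le> s" "s \<le> 1" and e: "0 \<le> e" "e \<le> 1"
  defines "B \<equiv> four_block_mat ((s / 2) \<cdot>\<^sub>m A) M M (- ((6 * s / 2) \<cdot>\<^sub>m M) - (3 * s * e\<^sup>2 / 2) \<cdot>\<^sub>m A)"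
    and "P \<equiv> four_block_mat ((s / 2) \<cdot>\<^sub>m A + M) (0\<^sub>m n n) (0\<^sub>m n n) ((s / 2 * e\<^sup>2) \<cdot>\<^sub>m A + M)"
  assumes ev: "eigenvalue (map_mat complex_of_real (the (mat_inverse P) * B)) \<mu>"
  shows "1 / 18 * max s e \<le> cmod \<mu> \<and> cmod \<mu> \<le> 5"
proof -
  let ?c = "map_mat complex_of_real"
  have Ac: "A \<in> carrier_mat n n" and Mc: "M \<in> carrier_mat n n"
    using A M by (auto simp: pos_def_def pos_semidef_def)
  define P1 where "P1 = (s / 2) \<cdot>\<^sub>m A + M"
  define P2 where "P2 = (s / 2 * e\<^sup>2) \<cdot>\<^sub>m A + M"
  define B2 where "B2 = - ((6 * s / 2) \<cdot>\<^sub>m M) - (3 * s * e\<^sup>2 / 2) \<cdot>\<^sub>m A"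
  have P_eq: "P = four_block_mat P1 (0\<^sub>m n n) (0\<^sub>m n n) P2"
    by (simp add: P_def P1_def P2_def)
  have B_eq: "B = four_block_mat ((s / 2) \<cdot>\<^sub>m A) M M B2"
    by (simp add: B_def B2_def)
  have P12: "pos_def n P1" "pos_def n P2"
    unfolding P1_def P2_def using A M s by (auto intro!: pos_def_add pos_semidef_smult)
  have carr [simp]: "P1 \<in> carrier_mat n n" "P2 \<in> carrier_mat n n" "B2 \<in> carrier_mat n n"
    using Ac Mc by (auto simp: P1_def P2_def B2_def)
  have Pc: "P \<in> carrier_mat (n + n) (n + n)" and Bc: "B \<in> carrier_mat (n + n) (n + n)"
    unfolding P_eq B_eq using Ac Mc by auto
  \<comment> \<open>\<open>P\<close> is block diagonal with positive definite blocks, hence has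
    trivial kernel and a genuine inverse.\<close>
  have "v = 0\<^sub>v (n + n)" if v: "v \<in> carrier_vec (n + n)" and Pv: "P *\<^sub>v v = 0\<^sub>v (n + n)" for v
  proof -
    have split: "v = vec_first v n @\<^sub>v vec_last v n" using v by simp
    have "P *\<^sub>v (vec_first v n @\<^sub>v vec_last v n) = P1 *\<^sub>v vec_first v n @\<^sub>v P2 *\<^sub>v vec_last v n"
      unfolding P_eq by (intro mult_mat_vec_split) auto
    then have "P1 *\<^sub>v vec_first v n @\<^sub>v P2 *\<^sub>v vec_last v n = 0\<^sub>v n @\<^sub>v 0\<^sub>v n"
      using Pv split by (metis zero_append)
    then have "P1 *\<^sub>v vec_first v n = 0\<^sub>v n \<and> P2 *\<^sub>v vec_last v n = 0\<^sub>v n"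
      by (intro append_vec_eq[where n = n, THEN iffD1]) (auto intro!: mult_mat_vec_carrier[OF carr(1)])
    then have "vec_first v n = 0\<^sub>v n" "vec_last v n = 0\<^sub>v n"
      using pos_def_kernel[OF P12(1)] pos_def_kernel[OF P12(2)] by auto
    then have "v = 0\<^sub>v n @\<^sub>v 0\<^sub>v n" using split by simp
    then show ?thesis by (simp only: zero_append)
  qed
  note Pinv = the_mat_inverse[OF Pc this]
  obtain w where w: "w \<in> carrier_vec (n + n)" "w \<noteq> 0\<^sub>v (n + n)"
    and w_eq: "?c (the (mat_inverse P) * B) *\<^sub>v w = \<mu> \<cdot>\<^sub>v w"
    using ev Pinv(1) unfolding eigenvalue_def eigenvector_def by auto
  \<comment> \<open>Multiplying by \<open>P\<close> gives the generalized problem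
    \<open>B w = \<mu> P w\<close>, which is free of the inverse and can be read block by
    block.\<close>
  have "?c B *\<^sub>v w = ?c (P * (the (mat_inverse P) * B)) *\<^sub>v w"
    using Pinv Pc Bc by (simp flip: assoc_mult_mat)
  also have "\<dots> = ?c P *\<^sub>v (?c (the (mat_inverse P) * B) *\<^sub>v w)"
    using Pinv Pc Bc w(1) by (subst of_real_hom.mat_hom_mult[OF Pc]) (auto intro!: assoc_mult_mat_vec)
  also have "\<dots> = \<mu> \<cdot>\<^sub>v (?c P *\<^sub>v w)"
    unfolding w_eq using Pc w(1) by (auto intro!: mult_mat_vec)
  finally have Bw: "?c B *\<^sub>v w = \<mu> \<cdot>\<^sub>v (?c P *\<^sub>v w)" .
  define x where "x = vec_first w n"
  define y where "y = vec_last w n"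
  have x: "x \<in> carrier_vec n" and y: "y \<in> carrier_vec n" and w_xy: "w = x @\<^sub>v y"
    using w(1) by (auto simp: x_def y_def)
  have "(?c ((s / 2) \<cdot>\<^sub>m A) *\<^sub>v x + ?c M *\<^sub>v y) @\<^sub>v (?c M *\<^sub>v x + ?c B2 *\<^sub>v y) =
      \<mu> \<cdot>\<^sub>v (?c P1 *\<^sub>v x @\<^sub>v ?c P2 *\<^sub>v y)"
  proof -
    have "?c B = four_block_mat (?c ((s / 2) \<cdot>\<^sub>m A)) (?c M) (?c M) (?c B2)"
      unfolding B_eq using Ac Mc by (intro map_four_block_mat) auto
    then have "?c B *\<^sub>v w = (?c ((s / 2) \<cdot>\<^sub>m A) *\<^sub>v x + ?c M *\<^sub>v y) @\<^sub>v (?c M *\<^sub>v x + ?c B2 *\<^sub>v y)"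
      unfolding w_xy using x y Ac Mc by (simp add: four_block_mat_mult_vec[where ?nr1.0 = n and ?nr2.0 = n and ?nc1.0 = n and ?nc2.0 = n])
    moreover have "?c P = four_block_mat (?c P1) (0\<^sub>m n n) (0\<^sub>m n n) (?c P2)"
      unfolding P_eq by (subst map_four_block_mat[of _ n n _ n _ n]) (auto intro!: arg_cong2[where f = "\<lambda>x y. four_block_mat _ x y _"])
    then have "?c P *\<^sub>v w = ?c P1 *\<^sub>v x @\<^sub>v ?c P2 *\<^sub>v y"
      unfolding w_xy using x y by (simp add: mult_mat_vec_split[where n = n and m = n])
    ultimately show ?thesis using Bw by simp
  qed
  also have "\<dots> = \<mu> \<cdot>\<^sub>v (?c P1 *\<^sub>v x) @\<^sub>v \<mu> \<cdot>\<^sub>v (?c P2 *\<^sub>v y)"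
    by (rule eq_vecI) auto
  finally have "?c ((s / 2) \<cdot>\<^sub>m A) *\<^sub>v x + ?c M *\<^sub>v y = \<mu> \<cdot>\<^sub>v (?c P1 *\<^sub>v x) \<and>
      ?c M *\<^sub>v x + ?c B2 *\<^sub>v y = \<mu> \<cdot>\<^sub>v (?c P2 *\<^sub>v y)"
    by (rule append_vec_eq[where n = n, THEN iffD1, rotated 2]) (use carrier_matD(1)[OF Mc] carrier_matD(1)[OF carr(1)] in \<open>auto intro: carrier_vecI\<close>)
  then have blocks: "?c ((s / 2) \<cdot>\<^sub>m A) *\<^sub>v x + ?c M *\<^sub>v y = \<mu> \<cdot>\<^sub>v (?c P1 *\<^sub>v x)"
      "?c M *\<^sub>v x + ?c B2 *\<^sub>v y = \<mu> \<cdot>\<^sub>v (?c P2 *\<^sub>v y)"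
    by auto
  define N where "N = ?c (the (mat_inverse M))"
  note Minv = the_mat_inverse[OF Mc pos_def_kernel[OF M]]
  have Nc: "N \<in> carrier_mat n n" using Minv by (simp add: N_def)
  \<comment> \<open>\<open>T\<close> is the inverse of \<open>M\<close> times \<open>A\<close>. Once
    \<open>N\<close> is applied to the block rows, only \<open>T\<close> and scalars act on
    \<open>x\<close> and \<open>y\<close>, so the elimination proceeds as with commuting
    numbers.\<close>
  define T where "T = N * ?c A"
  have T: "T \<in> carrier_mat n n" using Nc Ac by (simp add: T_def)
  have MN: "?c M * N = 1\<^sub>m n" "N * ?c M = 1\<^sub>m n"
    unfolding N_def using Minv Mc by (simp_all flip: of_real_hom.mat_hom_mult add: of_real_hom.mat_hom_one)
  have N_A: "N *\<^sub>v (?c A *\<^sub>v v) = T *\<^sub>v v" and N_M: "N *\<^sub>v (?c M *\<^sub>v v) = v"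
    and M_T: "?c M *\<^sub>v (T *\<^sub>v v) = ?c A *\<^sub>v v" if v: "v \<in> carrier_vec n" for v
  proof -
    show N_A: "N *\<^sub>v (?c A *\<^sub>v v) = T *\<^sub>v v"
      unfolding T_def using v Nc Ac by (intro assoc_mult_mat_vec[symmetric]) auto
    have "N *\<^sub>v (?c M *\<^sub>v v) = (N * ?c M) *\<^sub>v v"
      using v Nc Mc by (intro assoc_mult_mat_vec[symmetric]) auto
    then show "N *\<^sub>v (?c M *\<^sub>v v) = v"
      using v by (simp add: MN)
    have "?c M *\<^sub>v (N *\<^sub>v (?c A *\<^sub>v v)) = (?c M * N) *\<^sub>v (?c A *\<^sub>v v)"
      using v Nc Mc Ac by (intro assoc_mult_mat_vec[symmetric]) auto
    then show "?c M *\<^sub>v (T *\<^sub>v v) = ?c A *\<^sub>v v"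
      using v Ac by (simp add: MN flip: N_A)
  qed
  have cA: "?c A *\<^sub>v v \<in> carrier_vec n" and cM: "?c M *\<^sub>v v \<in> carrier_vec n" if "v \<in> carrier_vec n" for v
    using Ac Mc that by (auto intro!: carrier_vecI)
  have N_combination: "N *\<^sub>v (a \<cdot>\<^sub>v (?c A *\<^sub>v v) + b \<cdot>\<^sub>v (?c M *\<^sub>v v')) = a \<cdot>\<^sub>v (T *\<^sub>v v) + b \<cdot>\<^sub>v v'"
    if "v \<in> carrier_vec n" "v' \<in> carrier_vec n" for v v' a b
    using that Nc Ac Mc
    by (subst mult_add_distrib_mat_vec[where nr = n and nc = n]) (auto simp: mult_mat_vec[where nr = n and nc = n] N_A N_M)
  have N_smult: "N *\<^sub>v (\<mu> \<cdot>\<^sub>v v) = \<mu> \<cdot>\<^sub>v (N *\<^sub>v v)" if "v \<in> carrier_vec n" for v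
    using that Nc by (rule mult_mat_vec[rotated])
  have B2_eq: "B2 = (- 3 * s * e\<^sup>2 / 2) \<cdot>\<^sub>m A + (- 3 * s) \<cdot>\<^sub>m M"
    unfolding B2_def using Ac Mc by (intro eq_matI) auto
  have P1_eq: "P1 = (s / 2) \<cdot>\<^sub>m A + 1 \<cdot>\<^sub>m M" and P2_eq: "P2 = (s / 2 * e\<^sup>2) \<cdot>\<^sub>m A + 1 \<cdot>\<^sub>m M"
    unfolding P1_def P2_def by (rule eq_matI; simp)+
  have smult_A: "?c ((s / 2) \<cdot>\<^sub>m A) *\<^sub>v x = of_real (s / 2) \<cdot>\<^sub>v (?c A *\<^sub>v x)"
    using x Ac by (intro eq_vecI) (auto simp: map_smult_of_real)
  define tx where "tx = T *\<^sub>v x"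
  define ty where "ty = T *\<^sub>v y"
  define ttx where "ttx = T *\<^sub>v tx"
  have tc: "tx \<in> carrier_vec n" "ty \<in> carrier_vec n" "ttx \<in> carrier_vec n"
    using T x y by (auto simp: tx_def ty_def ttx_def)
  \<comment> \<open>The coefficients are those for which the two block rows read
    \<open>y = (\<alpha> + \<beta> T) x\<close> and
    \<open>x = (\<gamma> + \<delta> T) y\<close>.\<close>
  define \<alpha> where "\<alpha> = \<mu>"
  define \<beta> where "\<beta> = (\<mu> - 1) * of_real (s / 2)"
  define \<gamma> where "\<gamma> = \<mu> + 3 * of_real s"
  define \<delta> where "\<delta> = (\<mu> + 3) * of_real (s / 2 * e\<^sup>2)"
  have "of_real (s / 2) \<cdot>\<^sub>v tx + 1 \<cdot>\<^sub>v y = \<mu> \<cdot>\<^sub>v (of_real (s / 2) \<cdot>\<^sub>v tx + of_real 1 \<cdot>\<^sub>v x)"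
  proof -
    have "of_real (s / 2) \<cdot>\<^sub>v tx + 1 \<cdot>\<^sub>v y = N *\<^sub>v (of_real (s / 2) \<cdot>\<^sub>v (?c A *\<^sub>v x) + 1 \<cdot>\<^sub>v (?c M *\<^sub>v y))"
      by (simp only: tx_def N_combination[OF x y])
    also have "\<dots> = N *\<^sub>v (\<mu> \<cdot>\<^sub>v (of_real (s / 2) \<cdot>\<^sub>v (?c A *\<^sub>v x) + of_real 1 \<cdot>\<^sub>v (?c M *\<^sub>v x)))"
      using blocks(1) unfolding P1_eq linear_combination_mult_mat_vec[OF Ac Mc x] smult_A by simp
    also have "\<dots> = \<mu> \<cdot>\<^sub>v (N *\<^sub>v (of_real (s / 2) \<cdot>\<^sub>v (?c A *\<^sub>v x) + of_real 1 \<cdot>\<^sub>v (?c M *\<^sub>v x)))"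
      by (rule N_smult) (use cA[OF x] cM[OF x] in auto)
    finally show ?thesis
      by (simp only: tx_def N_combination[OF x x])
  qed
  then have y_eq: "y = \<alpha> \<cdot>\<^sub>v x + \<beta> \<cdot>\<^sub>v tx"
    using x y tc by (auto simp: vec_eq_iff \<alpha>_def \<beta>_def algebra_simps diff_divide_distrib add_divide_distrib)
  have "x + (of_real (- 3 * s * e\<^sup>2 / 2) \<cdot>\<^sub>v ty + of_real (- 3 * s) \<cdot>\<^sub>v y) =
      \<mu> \<cdot>\<^sub>v (of_real (s / 2 * e\<^sup>2) \<cdot>\<^sub>v ty + of_real 1 \<cdot>\<^sub>v y)"
  proof -
    have "x + (of_real (- 3 * s * e\<^sup>2 / 2) \<cdot>\<^sub>v ty + of_real (- 3 * s) \<cdot>\<^sub>v y) =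
        N *\<^sub>v (?c M *\<^sub>v x) +
        N *\<^sub>v (of_real (- 3 * s * e\<^sup>2 / 2) \<cdot>\<^sub>v (?c A *\<^sub>v y) + of_real (- 3 * s) \<cdot>\<^sub>v (?c M *\<^sub>v y))"
      by (simp only: ty_def N_combination[OF y y] N_M[OF x])
    also have "\<dots> = N *\<^sub>v (?c M *\<^sub>v x +
        (of_real (- 3 * s * e\<^sup>2 / 2) \<cdot>\<^sub>v (?c A *\<^sub>v y) + of_real (- 3 * s) \<cdot>\<^sub>v (?c M *\<^sub>v y)))"
      by (rule mult_add_distrib_mat_vec[OF Nc, symmetric]) (use cA[OF y] cM[OF x] cM[OF y] in auto)
    also have "\<dots> = N *\<^sub>v (\<mu> \<cdot>\<^sub>v (of_real (s / 2 * e\<^sup>2) \<cdot>\<^sub>v (?c A *\<^sub>v y) + of_real 1 \<cdot>\<^sub>v (?c M *\<^sub>v y)))"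
      using blocks(2) unfolding P2_eq B2_eq linear_combination_mult_mat_vec[OF Ac Mc y] by simp
    also have "\<dots> = \<mu> \<cdot>\<^sub>v (N *\<^sub>v (of_real (s / 2 * e\<^sup>2) \<cdot>\<^sub>v (?c A *\<^sub>v y) + of_real 1 \<cdot>\<^sub>v (?c M *\<^sub>v y)))"
      by (rule N_smult) (use cA[OF y] cM[OF y] in auto)
    finally show ?thesis
      by (simp only: ty_def N_combination[OF y y])
  qed
  then have x_eq: "x = \<gamma> \<cdot>\<^sub>v y + \<delta> \<cdot>\<^sub>v ty"
    using x y tc by (auto simp: vec_eq_iff \<gamma>_def \<delta>_def algebra_simps diff_divide_distrib add_divide_distrib)
  have "T *\<^sub>v (\<alpha> \<cdot>\<^sub>v x + \<beta> \<cdot>\<^sub>v tx) = \<alpha> \<cdot>\<^sub>v tx + \<beta> \<cdot>\<^sub>v ttx"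
    using T x tc
    by (subst mult_add_distrib_mat_vec[where nr = n and nc = n])
      (auto simp: mult_mat_vec[where nr = n and nc = n] ttx_def tx_def[symmetric])
  then have ty_eq: "ty = \<alpha> \<cdot>\<^sub>v tx + \<beta> \<cdot>\<^sub>v ttx"
    by (simp add: ty_def flip: y_eq)
  \<comment> \<open>Inserting the first relation into the second gives
    \<open>(\<gamma> + \<delta> T) (\<alpha> + \<beta> T) x = x\<close>, a quadratic polynomial in
    \<open>T\<close> that annihilates \<open>x\<close>.\<close>
  have "(\<beta> * \<delta>) \<cdot>\<^sub>v (T *\<^sub>v (T *\<^sub>v x)) + (\<alpha> * \<delta> + \<beta> * \<gamma>) \<cdot>\<^sub>v (T *\<^sub>v x) + (\<alpha> * \<gamma> - 1) \<cdot>\<^sub>v x = 0\<^sub>v n"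
  proof (rule eq_vecI)
    fix i assume "i < dim_vec (0\<^sub>v n :: complex vec)"
    then have i: "i < n" by simp
    have "vec_index x i = \<gamma> * vec_index y i + \<delta> * vec_index ty i"
      using arg_cong[OF x_eq, of "\<lambda>v. vec_index v i"] i x y tc by simp
    moreover have "vec_index y i = \<alpha> * vec_index x i + \<beta> * vec_index tx i"
      using arg_cong[OF y_eq, of "\<lambda>v. vec_index v i"] i x y tc by simp
    moreover have "vec_index ty i = \<alpha> * vec_index tx i + \<beta> * vec_index ttx i"
      using arg_cong[OF ty_eq, of "\<lambda>v. vec_index v i"] i x y tc by simp
    ultimately have E: "vec_index x i = \<gamma> * (\<alpha> * vec_index x i + \<beta> * vec_index tx i) +
        \<delta> * (\<alpha> * vec_index tx i + \<beta> * vec_index ttx i)"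
      by metis
    have "\<beta> * \<delta> * vec_index ttx i + (\<alpha> * \<delta> + \<beta> * \<gamma>) * vec_index tx i + (\<alpha> * \<gamma> - 1) * vec_index x i =
        \<gamma> * (\<alpha> * vec_index x i + \<beta> * vec_index tx i) +
        \<delta> * (\<alpha> * vec_index tx i + \<beta> * vec_index ttx i) - vec_index x i"
      by (simp add: algebra_simps)
    also have "\<dots> = 0"
      by (simp only: E[symmetric] diff_self)
    finally have "\<beta> * \<delta> * vec_index ttx i + (\<alpha> * \<delta> + \<beta> * \<gamma>) * vec_index tx i + (\<alpha> * \<gamma> - 1) * vec_index x i = 0" .
    then show "vec_index ((\<beta> * \<delta>) \<cdot>\<^sub>v (T *\<^sub>v (T *\<^sub>v x)) + (\<alpha> * \<delta> + \<beta> * \<gamma>) \<cdot>\<^sub>v (T *\<^sub>v x) + (\<alpha> * \<gamma> - 1) \<cdot>\<^sub>v x) i =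
        vec_index (0\<^sub>v n) i"
      unfolding tx_def[symmetric] ttx_def[symmetric] using i x tc by (simp add: add.assoc)
  qed (use x in simp)
  \<comment> \<open>\<open>y\<close> is determined by \<open>x\<close>, so \<open>x = 0\<close>
    would make the whole eigenvector vanish.\<close>
  moreover have "x \<noteq> 0\<^sub>v n"
  proof
    assume x0: "x = 0\<^sub>v n"
    then have "tx = 0\<^sub>v n" using T by (auto simp: tx_def)
    then have "y = 0\<^sub>v n"
      unfolding y_eq using x0 by (intro eq_vecI) auto
    with x0 w(2) w_xy show False
      by (simp add: zero_append)
  qed
  ultimately obtain t where t: "\<beta> * \<delta> * t\<^sup>2 + (\<alpha> * \<delta> + \<beta> * \<gamma>) * t + (\<alpha> * \<gamma> - 1) = 0"
    and t_cases: "t = 0 \<or> eigenvalue T t"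
    using root_of_annihilating_quadratic[OF T x] by blast
  \<comment> \<open>An eigenvector \<open>v\<close> of \<open>T\<close> satisfies
    \<open>A v = t M v\<close>, so the Rayleigh quotient applies.\<close>
  have "\<exists>r\<ge>0. t = of_real r"
    using t_cases
  proof
    assume "eigenvalue T t"
    then obtain v where v: "v \<in> carrier_vec n" "v \<noteq> 0\<^sub>v n" and Tv: "T *\<^sub>v v = t \<cdot>\<^sub>v v"
      using T unfolding eigenvalue_def eigenvector_def by auto
    have "?c A *\<^sub>v v = t \<cdot>\<^sub>v (?c M *\<^sub>v v)"
      unfolding M_T[OF v(1), symmetric] Tv using v Mc by (intro mult_mat_vec[where nr = n and nc = n]) auto
    then show ?thesis
      by (rule generalized_eigenvalue_nonneg[OF A M v])
  qed (auto intro: exI[of _ 0])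
  then obtain r where r: "0 \<le> r" "t = of_real r" by blast
  \<comment> \<open>The quadratic is factored again: with \<open>u = s * r / 2\<close> the two
    factors are exactly those in \<open>pencil_root_bounds\<close>.\<close>
  have "(\<alpha> + \<beta> * t) * (\<gamma> + \<delta> * t) =
      (\<beta> * \<delta> * t\<^sup>2 + (\<alpha> * \<delta> + \<beta> * \<gamma>) * t + (\<alpha> * \<gamma> - 1)) + 1"
    by (simp add: algebra_simps power2_eq_square)
  then have "(\<alpha> + \<beta> * t) * (\<gamma> + \<delta> * t) = 1"
    unfolding t by simp
  moreover have "\<alpha> + \<beta> * t = \<mu> * (1 + of_real (s * r / 2)) - of_real (s * r / 2)"
    by (simp add: \<alpha>_def \<beta>_def r field_simps)
  moreover have "\<gamma> + \<delta> * t = \<mu> * (1 + of_real (e\<^sup>2) * of_real (s * r / 2)) + 3 * of_real s +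
      3 * of_real (e\<^sup>2) * of_real (s * r / 2)"
    by (simp add: \<gamma>_def \<delta>_def r field_simps)
  ultimately have "(\<mu> * (1 + of_real (s * r / 2)) - of_real (s * r / 2)) *
      (\<mu> * (1 + of_real (e\<^sup>2) * of_real (s * r / 2)) + 3 * of_real s + 3 * of_real (e\<^sup>2) * of_real (s * r / 2)) = 1"
    by simp
  then show ?thesis
    using pencil_root_bounds[OF s e, of "s * r / 2" \<mu>] s r by simp
qed

section \<open>The finite element matrices\<close>

text \<open>Continuity of the gradient on the whole space is recorded because it later yields
  integrability over each compact element.\<close>

lemma poly2_GDERIV:
  fixes p :: "real^'d \<Rightarrow> real"
  assumes "p \<in> poly2"
  shows "\<exists>G. continuous_on UNIV G \<and> (\<forall>x. GDERIV p x :> G x)"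
proof -
  from assms obtain a b q where p:
    "p = (\<lambda>x. a + (\<Sum>i\<in>UNIV. b i * x$i) + (\<Sum>i\<in>UNIV. \<Sum>j\<in>UNIV. q i j * x$i * x$j))"
    unfolding poly2_def by blast
  \<comment> \<open>The coefficients \<open>q\<close> need not be symmetric, so each product
    \<open>x$i * x$j\<close> contributes to both axes separately.\<close>
  define G where "G = (\<lambda>x::real^'d. (\<Sum>i\<in>UNIV. b i *\<^sub>R axis i 1) +
    (\<Sum>i\<in>UNIV. \<Sum>j\<in>UNIV. (q i j * x$j) *\<^sub>R axis i 1 + (q i j * x$i) *\<^sub>R axis j (1::real)))"
  have G_cont: "continuous_on UNIV G"
    unfolding G_def by (intro continuous_intros)
  have "GDERIV p x :> G x" for x
  proof -
    have coord: "((\<lambda>x. x$i) has_derivative (\<lambda>h. h$i)) (at x)" for i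
      by (rule bounded_linear.has_derivative[OF bounded_linear_vec_nth has_derivative_ident])
    have linear: "((\<lambda>x. b i * x$i) has_derivative (\<lambda>h. b i * h$i)) (at x)" for i
      by (rule has_derivative_mult_right[OF coord])
    have quadratic: "((\<lambda>x. q i j * x$i * x$j) has_derivative
        (\<lambda>h. q i j * h$i * x$j + q i j * x$i * h$j)) (at x)" for i j
      by (rule has_derivative_eq_rhs[OF has_derivative_mult[OF has_derivative_mult_right[OF coord] coord]])
        (simp add: fun_eq_iff algebra_simps)
    have "(p has_derivative (\<lambda>h. 0 + (\<Sum>i\<in>UNIV. b i * h$i) +
        (\<Sum>i\<in>UNIV. \<Sum>j\<in>UNIV. q i j * h$i * x$j + q i j * x$i * h$j))) (at x)"
      unfolding p by (intro has_derivative_add has_derivative_const has_derivative_sum linear quadratic)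
    moreover have "(\<lambda>h. 0 + (\<Sum>i\<in>UNIV. b i * h$i) +
        (\<Sum>i\<in>UNIV. \<Sum>j\<in>UNIV. q i j * h$i * x$j + q i j * x$i * h$j)) = (\<lambda>h. inner h (G x))"
      by (simp add: G_def fun_eq_iff inner_add_right inner_sum_right inner_axis mult_ac)
    ultimately show ?thesis
      by (simp add: gderiv_def)
  qed
  with G_cont show ?thesis by blast
qed

text \<open>\<open>gradient\<close> is a definite description, so its value is known only once the
  representing vector is shown to be unique.\<close>

lemma gradient_eqI:
  assumes "GDERIV u x :> D"
  shows "gradient u x = D"
  unfolding gradient_def
proof (rule the_equality)
  show "GDERIV u x :> D" by fact
  fix D' assume "GDERIV u x :> D'"
  then have "(\<lambda>h. inner h D') = (\<lambda>h. inner h D)"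
    using assms has_derivative_unique unfolding gderiv_def by blast
  \<comment> \<open>Testing both representations in the direction \<open>D' - D\<close> makes the
    squared norm of that difference zero.\<close>
  then have "inner (D' - D) D' = inner (D' - D) D"
    by (rule fun_cong)
  then have "inner (D' - D) (D' - D) = 0"
    by (simp add: inner_diff_right)
  then show "D' = D" by simp
qed

section \<open>Set integrals of double sums and of continuous functions\<close>

lemma
  fixes F :: "'i \<Rightarrow> 'j \<Rightarrow> 'a \<Rightarrow> real"
  assumes F: "\<And>i j. i \<in> I \<Longrightarrow> j \<in> J \<Longrightarrow> set_integrable M A (F i j)"
  shows set_integrable_double_sum: "set_integrable M A (\<lambda>x. \<Sum>i\<in>I. \<Sum>j\<in>J. F i j x)"
    and set_integral_double_sum:
      "(LINT x:A|M. \<Sum>i\<in>I. \<Sum>j\<in>J. F i j x) = (\<Sum>i\<in>I. \<Sum>j\<in>J. LINT x:A|M. F i j x)"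
proof -
  show "set_integrable M A (\<lambda>x. \<Sum>i\<in>I. \<Sum>j\<in>J. F i j x)"
    using F unfolding set_integrable_def scaleR_sum_right
    by (intro Bochner_Integration.integrable_sum) auto
  have "(LINT x:A|M. \<Sum>i\<in>I. \<Sum>j\<in>J. F i j x) =
      (\<Sum>i\<in>I. LINT x|M. (\<Sum>j\<in>J. indicat_real A x *\<^sub>R F i j x))"
    using F unfolding set_lebesgue_integral_def set_integrable_def scaleR_sum_right
    by (intro Bochner_Integration.integral_sum Bochner_Integration.integrable_sum) auto
  also have "\<dots> = (\<Sum>i\<in>I. \<Sum>j\<in>J. LINT x:A|M. F i j x)"
    using F unfolding set_lebesgue_integral_def set_integrable_def
    by (intro sum.cong refl Bochner_Integration.integral_sum) auto
  finally show "(LINT x:A|M. \<Sum>i\<in>I. \<Sum>j\<in>J. F i j x) = (\<Sum>i\<in>I. \<Sum>j\<in>J. LINT x:A|M. F i j x)" .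
qed

text \<open>Continuity on the compact superset keeps \<open>f\<close> bounded up to the boundary of
  \<open>T\<close>. Used with an element and its interior, and with the closure of \<Omega> and
  \<Omega> itself.\<close>

lemma absolutely_integrable_continuous_compact:
  fixes f :: "'a::euclidean_space \<Rightarrow> real"
  assumes "compact S" "continuous_on S f" "T \<subseteq> S" "T \<in> sets lebesgue"
  shows "set_integrable lebesgue T f"
proof (rule set_integrable_subset)
  have "set_integrable lborel S f"
    unfolding set_integrable_def using assms by (intro borel_integrable_compact) auto
  then show "set_integrable lebesgue S f"
    by (simp add: set_integrable_def integrable_completion borel_measurable_integrable)
qed (use assms in auto)

section \<open>Mass and stiffness matrices on a single mesh\<close>

locale triangulated =
  fixes \<Omega> :: "(real^'d) set" and \<T> :: "(real^'d) set set"
  assumes open_domain: "open \<Omega>" and bounded_domain: "bounded \<Omega>"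
    and triangulates: "triangulates \<T> \<Omega>"
begin

lemma compact_closure_domain: "compact (closure \<Omega>)"
  using bounded_domain by (simp add: compact_closure)

lemma element_cell:
  assumes "K \<in> \<T>"
  shows "polytope K" "K \<subseteq> closure \<Omega>"
  using triangulates assms simplex_imp_polytope unfolding triangulates_def by blast+

lemma finite_mesh: "finite \<T>"
  using triangulates unfolding triangulates_def triangulation_def by blast

text \<open>Elements are convex, so their frontiers are null sets, and there are finitely many. All
  other points of \<Omega> lie in the interior of an element, where classical gradients
  exist.\<close>

lemma negligible_skeleton: "negligible (\<Omega> - (\<Union>K\<in>\<T>. interior K))"
proof (rule negligible_subset)
  show "negligible (\<Union>K\<in>\<T>. frontier K)"
    using finite_mesh element_cell(1)
    by (auto intro!: negligible_Union negligible_convex_frontier polytope_imp_convex)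
  have "\<Omega> \<subseteq> \<Union>\<T>"
    using triangulates closure_subset unfolding triangulates_def by blast
  moreover have "K \<subseteq> interior K \<union> frontier K" for K :: "(real^'d) set"
    using closure_subset[of K] unfolding frontier_def by blast
  ultimately show "\<Omega> - (\<Union>K\<in>\<T>. interior K) \<subseteq> (\<Union>K\<in>\<T>. frontier K)"
    by blast
qed

text \<open>Around an interior point of \<open>K\<close> the function coincides with a polynomial
  and inherits its derivative.\<close>

lemma gradient_on_element:
  assumes "u \<in> fe_space \<Omega> \<T>" "K \<in> \<T>"
  shows "\<exists>G. continuous_on UNIV G \<and> (\<forall>x\<in>interior K. gradient u x = G x)"
proof -
  obtain p where p: "p \<in> poly2" "\<forall>x\<in>K. u x = p x"
    using assms unfolding fe_space_def by blast
  obtain G where G: "continuous_on UNIV G" "\<And>x. GDERIV p x :> G x"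
    using poly2_GDERIV[OF p(1)] by blast
  have "GDERIV u x :> G x" if "x \<in> interior K" for x
    using G(2)[of x] unfolding gderiv_def
    by (rule has_derivative_transform_within_open[of _ _ _ UNIV "interior K"])
      (use that p(2) interior_subset[of K] in auto)
  with G(1) show ?thesis by (blast intro: gradient_eqI)
qed

text \<open>The integral of a nonintegrable function is 0 by convention, so integrability has to be
  secured before the stiffness form can be written as one integral. It is obtained element by
  element.\<close>

lemma gradient_inner_integrable:
  assumes u: "u \<in> fe_space \<Omega> \<T>" and v: "v \<in> fe_space \<Omega> \<T>"
  shows "set_integrable lebesgue \<Omega> (\<lambda>x. inner (gradient u x) (gradient v x))"
    (is "set_integrable _ _ ?f")
proof -
  have "set_integrable lebesgue (interior K) ?f" if K: "K \<in> \<T>" for K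
  proof -
    obtain G where G: "continuous_on UNIV G" "\<And>x. x \<in> interior K \<Longrightarrow> gradient u x = G x"
      using gradient_on_element[OF u K] by blast
    obtain G' where G': "continuous_on UNIV G'" "\<And>x. x \<in> interior K \<Longrightarrow> gradient v x = G' x"
      using gradient_on_element[OF v K] by blast
    have "continuous_on K (\<lambda>x. inner (G x) (G' x))"
      using G(1) G'(1) by (intro continuous_on_inner) (auto elim: continuous_on_subset)
    then have "set_integrable lebesgue (interior K) (\<lambda>x. inner (G x) (G' x))"
      by (rule absolutely_integrable_continuous_compact[rotated])
        (use element_cell(1)[OF K] in \<open>auto simp: polytope_imp_compact interior_subset[THEN subsetD]\<close>)
    then show ?thesis
      by (rule set_integrable_cong[THEN iffD1, rotated 3]) (auto simp: G(2) G'(2))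
  qed
  then have "set_integrable lebesgue (\<Union>K\<in>\<T>. interior K) ?f"
    by (intro set_integrable_UN finite_mesh) auto
  \<comment> \<open>Elements are only known to lie in the closure of \<Omega>, so the union of their
    interiors is first cut down to \<Omega>; what is then missing from \<Omega> is
    negligible.\<close>
  then have "set_integrable lebesgue ((\<Union>K\<in>\<T>. interior K) \<inter> \<Omega>) ?f"
    by (rule set_integrable_subset)
      (use open_domain in \<open>auto intro!: sets_completionI_sets borel_open open_Int open_UN\<close>)
  then show ?thesis
    by (rule absolutely_integrable_spike_set)
      (auto intro: negligible_subset[OF negligible_skeleton] negligible_subset[OF negligible_empty])
qed

lemma mass_integrable:
  assumes "u \<in> fe_space \<Omega> \<T>" "v \<in> fe_space \<Omega> \<T>"
  shows "set_integrable lebesgue \<Omega> (\<lambda>x. u x * v x)"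
  using assms open_domain unfolding fe_space_def
  by (intro absolutely_integrable_continuous_compact[OF compact_closure_domain])
    (auto intro!: continuous_on_mult closure_subset[THEN subsetD])

text \<open>The form is the integral of the squared norm of
  \<open>\<Sum>i<n. v i *\<^sub>R gradient (\<phi> i) x\<close>; bilinearity of the inner product is
  enough for this, without differentiating the sum.\<close>

lemma stiffness_pos_semidef:
  assumes \<phi>: "\<And>k. k < n \<Longrightarrow> \<phi> k \<in> fe_space \<Omega> \<T>"
  shows "pos_semidef n (stiffness_mat \<Omega> n \<phi>)"
proof -
  have "0 \<le> form_on n (stiffness_mat \<Omega> n \<phi>) v" for v
  proof -
    let ?g = "\<lambda>i. gradient (\<phi> i)"
    have int: "set_integrable lebesgue \<Omega> (\<lambda>x. v i * v j * inner (?g i x) (?g j x))" if "i < n" "j < n" for i j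
      using gradient_inner_integrable[OF \<phi> \<phi>] that by (intro set_integrable_mult_right) auto
    have "form_on n (stiffness_mat \<Omega> n \<phi>) v =
        (\<Sum>i<n. \<Sum>j<n. LINT x:\<Omega>|lebesgue. v i * v j * inner (?g i x) (?g j x))"
      by (simp add: form_on_def stiffness_mat_def L2_inner_grad_def)
    also have "\<dots> = (LINT x:\<Omega>|lebesgue. \<Sum>i<n. \<Sum>j<n. v i * v j * inner (?g i x) (?g j x))"
      using int by (intro set_integral_double_sum[symmetric]) auto
    also have "\<dots> = (LINT x:\<Omega>|lebesgue. inner (\<Sum>i<n. v i *\<^sub>R ?g i x) (\<Sum>i<n. v i *\<^sub>R ?g i x))"
      by (simp add: inner_sum_left inner_sum_right inner_commute mult_ac sum_distrib_left)
    also have "0 \<le> \<dots>"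
      unfolding set_lebesgue_integral_def by (intro integral_nonneg_AE) simp
    finally show ?thesis .
  qed
  then show ?thesis
    by (auto simp: pos_semidef_def stiffness_mat_def L2_inner_grad_def inner_commute)
qed

lemma mass_form:
  assumes \<phi>: "\<And>k. k < n \<Longrightarrow> \<phi> k \<in> fe_space \<Omega> \<T>"
  shows "form_on n (mass_mat \<Omega> n \<phi>) v = (LINT x:\<Omega>|lebesgue. (\<Sum>i<n. v i * \<phi> i x)\<^sup>2)"
    and "set_integrable lebesgue \<Omega> (\<lambda>x. (\<Sum>i<n. v i * \<phi> i x)\<^sup>2)"
proof -
  have int: "set_integrable lebesgue \<Omega> (\<lambda>x. v i * v j * (\<phi> i x * \<phi> j x))" if "i < n" "j < n" for i j
    using mass_integrable[OF \<phi> \<phi>] that by (intro set_integrable_mult_right) auto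
  have expand: "(\<Sum>i<n. v i * \<phi> i x)\<^sup>2 = (\<Sum>i<n. \<Sum>j<n. v i * v j * (\<phi> i x * \<phi> j x))" for x
    by (simp add: power2_eq_square sum_product mult_ac)
  show "set_integrable lebesgue \<Omega> (\<lambda>x. (\<Sum>i<n. v i * \<phi> i x)\<^sup>2)"
    unfolding expand using int by (intro set_integrable_double_sum) auto
  have "form_on n (mass_mat \<Omega> n \<phi>) v =
      (\<Sum>i<n. \<Sum>j<n. LINT x:\<Omega>|lebesgue. v i * v j * (\<phi> i x * \<phi> j x))"
    by (simp add: form_on_def mass_mat_def L2_inner_def)
  also have "\<dots> = (LINT x:\<Omega>|lebesgue. (\<Sum>i<n. v i * \<phi> i x)\<^sup>2)"
    unfolding expand using int by (intro set_integral_double_sum[symmetric]) auto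
  finally show "form_on n (mass_mat \<Omega> n \<phi>) v = (LINT x:\<Omega>|lebesgue. (\<Sum>i<n. v i * \<phi> i x)\<^sup>2)" .
qed

text \<open>By convexity an element contains the midpoints of its vertices. This allows finite
  element functions to be evaluated at nodes within their domain of continuity.\<close>

lemma nodes_in_closure: "nodes \<T> \<subseteq> closure \<Omega>"
proof
  fix z assume "z \<in> nodes \<T>"
  then obtain u w K where z: "z = midpoint u w" and K: "K \<in> \<T>" and "u \<in> K" "w \<in> K"
    unfolding nodes_def extreme_point_of_def by blast
  then have "z \<in> K"
    using midpoint_in_closed_segment closed_segment_subset[of u K w] polytope_imp_convex[OF element_cell(1)[OF K]]
    by blast
  then show "z \<in> closure \<Omega>" using element_cell(2)[OF K] by blast
qed

text \<open>If the form vanishes at \<open>v\<close>, the finite element function with coefficients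
  \<open>v\<close> is zero almost everywhere, hence everywhere by continuity, and its nodal values
  are the coefficients.\<close>

lemma mass_pos_def:
  assumes "nodal_basis \<Omega> \<T> \<phi>"
  defines "n \<equiv> fe_dim \<Omega> \<T>"
  shows "pos_def n (mass_mat \<Omega> n \<phi>)"
proof -
  obtain p where p: "bij_betw p {..<n} (nodes \<T>)"
    and \<phi>: "\<And>k. k < n \<Longrightarrow> \<phi> k \<in> fe_space \<Omega> \<T>"
    and nodal: "\<And>k l. k < n \<Longrightarrow> l < n \<Longrightarrow> \<phi> k (p l) = (if k = l then 1 else 0)"
    using assms unfolding nodal_basis_def by blast
  have "v l = 0" if zero: "form_on n (mass_mat \<Omega> n \<phi>) v = 0" and l: "l < n" for v l
  proof -
    define f where "f = (\<lambda>x. \<Sum>i<n. v i * \<phi> i x)"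
    have cont: "continuous_on (closure \<Omega>) f"
      unfolding f_def using \<phi> by (intro continuous_intros) (auto simp: fe_space_def)
    have int: "integrable lebesgue (\<lambda>x. indicat_real \<Omega> x *\<^sub>R (f x)\<^sup>2)"
      using mass_form(2)[OF \<phi>] by (simp add: f_def set_integrable_def)
    have "(LINT x|lebesgue. indicat_real \<Omega> x *\<^sub>R (f x)\<^sup>2) = 0"
      using zero mass_form(1)[OF \<phi>] by (simp add: f_def set_lebesgue_integral_def)
    then have "AE x in lebesgue. indicat_real \<Omega> x *\<^sub>R (f x)\<^sup>2 = 0"
      by (subst (asm) integral_nonneg_eq_0_iff_AE[OF int]) auto
    then have "AE x in lebesgue. x \<notin> \<Omega> \<inter> f -` (- {0})"
      by (rule AE_mp) (auto simp: indicator_def)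
    moreover have "open (\<Omega> \<inter> f -` (- {0}))"
      using open_domain continuous_on_subset[OF cont closure_subset]
      by (intro continuous_open_preimage) auto
    moreover have "negligible (\<Omega> \<inter> f -` (- {0}))"
      unfolding negligible_iff_null_sets completion.null_sets_iff_AE using calculation(1) by simp
    \<comment> \<open>The set where \<open>f\<close> is nonzero in \<Omega> is open and null; a
      nonempty open set is never null.\<close>
    ultimately have "\<Omega> \<inter> f -` (- {0}) = {}"
      using open_not_negligible by blast
    \<comment> \<open>Nodes may lie on the boundary, so the vanishing is extended from \<Omega> to
      its closure.\<close>
    then have "f x = 0" if "x \<in> closure \<Omega>" for x
      using continuous_constant_on_closure[OF cont _ that] by auto
    moreover have "p l \<in> closure \<Omega>"
      using p l nodes_in_closure by (auto simp: bij_betw_def)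
    moreover have "f (p l) = v l"
      using l by (simp add: f_def nodal if_distrib cong: if_cong)
    ultimately show ?thesis by simp
  qed
  moreover have "0 \<le> form_on n (mass_mat \<Omega> n \<phi>) v" for v
    using mass_form(1)[OF \<phi>, where v = v] by (simp add: set_lebesgue_integral_def)
  ultimately show ?thesis
    by (auto simp: pos_def_def pos_semidef_def mass_mat_def L2_inner_def mult.commute)
qed

end

theorem theorem3p2:
  fixes \<Omega> :: "(real^'d) set"
    and H :: "real set"
    and \<T> :: "real \<Rightarrow> (real^'d) set set"
  assumes "CARD('d) = 2 \<or> CARD('d) = 3"
    and "polyhedral_domain \<Omega>"
    and "quasi_uniform_family \<Omega> H \<T>"
  shows "\<exists>(C\<^sub>1::real)>0. \<exists>(C\<^sub>2::real)>0.
    \<forall>h\<in>H. \<forall>\<phi>. nodal_basis \<Omega> (\<T> h) \<phi> \<longrightarrow>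
      (let n = fe_dim \<Omega> (\<T> h);
           K = stiffness_mat \<Omega> n \<phi>;
           M = mass_mat \<Omega> n \<phi>;
           c = mean_col \<Omega> n \<phi>
       in \<forall>\<tau> \<epsilon>. 0 \<le> \<tau> \<and> \<tau> \<le> 1 \<and> 0 \<le> \<epsilon> \<and> \<epsilon> \<le> 1 \<longrightarrow>
            (let B = B_mat K M c \<tau> \<epsilon>;
                 P = P_mat n K M c \<tau> \<epsilon>
             in \<forall>\<mu>::complex.
                  eigenvalue (map_mat complex_of_real (the (mat_inverse P) * B)) \<mu> \<longrightarrow>
                  C\<^sub>2 * max (sqrt \<tau>) \<epsilon> \<le> cmod \<mu> \<and> cmod \<mu> \<le> C\<^sub>1))"
proof (rule exI[of _ 5], rule conjI, simp, rule exI[of _ "1 / 18"], rule conjI, simp, unfold Let_def, intro ballI allI impI)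
  \<comment> \<open>The witnesses 5 and 1/18 have been supplied before the mesh, the basis and the
    parameters are fixed; this order of quantifiers is the claimed independence.\<close>
  fix h \<phi> \<tau> \<epsilon> and \<mu> :: complex
  let ?n = "fe_dim \<Omega> (\<T> h)"
  let ?K = "stiffness_mat \<Omega> ?n \<phi>" and ?M = "mass_mat \<Omega> ?n \<phi>" and ?c = "mean_col \<Omega> ?n \<phi>"
  assume h: "h \<in> H" and basis: "nodal_basis \<Omega> (\<T> h) \<phi>"
    and range: "0 \<le> \<tau> \<and> \<tau> \<le> 1 \<and> 0 \<le> \<epsilon> \<and> \<epsilon> \<le> 1"
    and ev: "eigenvalue (map_mat complex_of_real (the (mat_inverse (P_mat ?n ?K ?M ?c \<tau> \<epsilon>)) * B_mat ?K ?M ?c \<tau> \<epsilon>)) \<mu>"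
  interpret triangulated \<Omega> "\<T> h"
    using assms(2,3) h by unfold_locales (auto simp: polyhedral_domain_def quasi_uniform_family_def)
  have "pos_semidef ?n (?K + ?c * transpose_mat ?c)"
    using basis
    by (intro pos_semidef_add stiffness_pos_semidef pos_semidef_outer_product)
      (auto simp: nodal_basis_def mean_col_def)
  then show "1 / 18 * max (sqrt \<tau>) \<epsilon> \<le> cmod \<mu> \<and> cmod \<mu> \<le> 5"
    using preconditioned_eigenvalue_bounds[OF _ mass_pos_def[OF basis], of _ "sqrt \<tau>" \<epsilon> \<mu>] range ev
    unfolding B_mat_def P_mat_def by simp
qed

end
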